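(* Let $T, k, M \ge 1$ be integers, $\varepsilon_q > 0$, $\tau \in \mathbb{R}$, and let $q_1,\dots,q_T \in \mathcal{V}^*$ be a sequence of queries. Consider the algorithm MuRAG (defined in the context), viewed as a randomized map that takes the private document dataset $D$ to the sequence of answers $(a_1,\dots,a_T)$. Let $\varepsilon>0$, and suppose that the initial privacy budget assigned to each document $z \in D$, namely $\mathcal{E}(z) = M\varepsilon_q$, is at most $\varepsilon$. Then MuRAG satisfies $\varepsilon$-differential privacy with respect to $D$ (under the add/remove-one-document neighboring relation).
   Context: **Privacy.** $\mathcal{V}$ is a finite vocabulary and $\mathcal{V}^*$ the set of finite token sequences. A document is an element of $\mathcal{V}^*$, and a dataset is a finite set of documents. Two datasets are neighboring (add/remove relation) if one is obtained from the other by adding or removing exactly one document. A randomized algorithm $\mathcal{M}$ is $\varepsilon$-differentially private ($\varepsilon$-DP) if $\Pr[\mathcal{M}(D)\in O]\le e^{\varepsilon}\Pr[\mathcal{M}(D')\in O]$ for all neighboring $D,D'$ and all measurable $O$. $\mathrm{Lap}(b)$ denotes a fresh independent draw from the Laplace distribution with mean $0$ and scale $b$. **Relevance, Top-K.** $r(z,q)\in\mathbb{R}$ is a fixed (data-independent) relevance score of document $z$ for query $q$. It is assumed that there are no ties. $\mathrm{TopK}(D,K,r(\cdot,q))$ returns the $K$ documents of $D$ of highest score $r(\cdot,q)$ if $|D|\ge K$. Otherwise it returns $D$ padded with $K-|D|$ empty strings, so that the output always has exactly $K$ entries. Padding entries are ranked below all real documents. **Language model.** $\mathrm{LLM}(x,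 C \mid y_{<t})\in\mathcal{V}$ is a fixed deterministic function (greedy decoding, public, independent of the private dataset). It gives the next token from a prompt $x$, a finite multiset $C$ of context documents, and the previously generated tokens $y_{<t}=(y_1,\dots,y_{t-1})$. **Single-query algorithm** $\mathrm{DPRAG}(x,D,\mathrm{LLM},\varepsilon)$. Fixed parameters: per-token budget $\varepsilon_0>0$, maximum number of tokens $T_{\max}$, number of voters $m$, documents per voter $k'$, vote threshold $\theta\in\mathbb{R}$. Put $\varepsilon_{\mathrm{Lap}}=\varepsilon_{\mathrm{Expo}}=\varepsilon_0/2$ and $c=\lfloor \varepsilon/\varepsilon_0\rfloor$ (the number of "discoveries" left). The procedure stops as soon as $c=0$. 1. Set $\hat\theta=\theta+\mathrm{Lap}(2/\varepsilon_{\mathrm{Lap}})$. 2. Let $D_x$ be the $mk'$ most relevant entries $\mathrm{TopK}(D,mk',r(\cdot,x))$. Split $D_x$ uniformly at random into $m$ chunks $D_x^{(1)},\dots,D_x^{(m)}$ of size $k'$ (the split is drawn once, independently of everything else). 3. For $t=1,\dots,T_{\max}$: - Let $b=\mathrm{LLM}(x,\emptyset\mid y_{<t})$ and $v_i=\mathrm{LLM}(x,D_x^{(i)}\mid y_{<t})$ for $i=1,\dots,m$. - For each $v\in\mathcal{V}$ let $u_v=|\{i: v_i=v\}|$, and let $s=u_b$. - If $s+\mathrm{Lap}(4/\varepsilon_{\mathrm{Lap}})\le\hat\theta$: draw $y_t\in\mathcal{V}$ with probability proportional to $\exp(\varepsilon_{\mathrm{Expo}}u_v/2)$ (exponential mechanism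 with utility sensitivity $1$), decrease $c$ by $1$, and redraw $\hat\theta=\theta+\mathrm{Lap}(2/\varepsilon_{\mathrm{Lap}})$. - Otherwise set $y_t=b$. - If $y_t$ is the end-of-sequence token or $c=0$, return $(y_1,\dots,y_t)$. 4. Return $(y_1,\dots,y_{T_{\max}})$. **Algorithm MuRAG.** Input: private dataset $D$, queries $q_1,\dots,q_T$, per-query budget $\varepsilon_q$, number $k$ of retrieved documents, maximum number $M$ of retrievals per document, fixed data-independent relevance threshold $\tau$. Initialize $\mathcal{E}(z)=M\varepsilon_q$ for every $z\in D$. For $t=1,\dots,T$: - $A_t=\{z\in D:\mathcal{E}(z)\ge\varepsilon_q\}$. - $D_{q_t}=\{z\in A_t: r(z,q_t)>\tau\}$. - For every $z\in D_{q_t}$, replace $\mathcal{E}(z)$ by $\mathcal{E}(z)-\varepsilon_q$. - $D_{q_t}^k=\mathrm{TopK}(D_{q_t},k,r(\cdot,q_t))$. - $a_t=\mathrm{DPRAG}(q_t,D_{q_t}^k,\mathrm{LLM},\varepsilon_q)$, with fresh randomness. Output $(a_1,\dots,a_T)$. *)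

theory Defs
  imports "HOL-Probability.Probability"
begin

definition neighbouring :: "'z set \<Rightarrow> 'z set \<Rightarrow> bool" where
  "neighbouring D D' \<longleftrightarrow> finite D \<and> finite D' \<and>
     (\<exists>z. (z \<notin> D \<and> D' = insert z D) \<or> (z \<notin> D' \<and> D = insert z D'))"

text \<open>
  The first conjunct says that the algorithm really is a randomized map into the measurable
  space \<open>N\<close>: on every dataset its output law is a probability measure on \<open>N\<close>.
\<close>

definition differentially_private ::
    "'o measure \<Rightarrow> real \<Rightarrow> ('z set \<Rightarrow> 'o measure) \<Rightarrow> bool" where
  "differentially_private N \<epsilon> Alg \<longleftrightarrow>
     (\<forall>D. finite D \<longrightarrow> Alg D \<in> space (prob_algebra N)) \<and>
     (\<forall>D D'. neighbouring D D' \<longrightarrow>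
        (\<forall>S \<in> sets N. measure (Alg D) S \<le> exp \<epsilon> * measure (Alg D') S))"

definition laplace :: "real \<Rightarrow> real measure" where
  "laplace b = density lborel (\<lambda>x. ennreal (exp (- \<bar>x\<bar> / b) / (2 * b)))"

text \<open>The factor \<open>\<epsilon> / 2\<close> is the one for a utility of sensitivity 1.\<close>

definition exponential_mechanism :: "real \<Rightarrow> ('v::finite \<Rightarrow> nat) \<Rightarrow> 'v pmf" where
  "exponential_mechanism \<epsilon> u =
     embed_pmf (\<lambda>v. exp (\<epsilon> * real (u v) / 2) / (\<Sum>w\<in>UNIV. exp (\<epsilon> * real (u w) / 2)))"

type_synonym 'v doc = "'v list"

text \<open>
  An entry of a retrieval result is a real document \<open>Some z\<close> or a padding entry \<open>None\<close>.  The
  distinction matters for ranking only, since the empty string may also occur as a real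
  document; the language model sees a padding entry as the empty string.
\<close>

type_synonym 'v entry = "'v doc option"

definition entry_text :: "'v entry \<Rightarrow> 'v doc" where
  "entry_text e = (case e of None \<Rightarrow> [] | Some z \<Rightarrow> z)"

definition entry_score :: "('v doc \<Rightarrow> real) \<Rightarrow> 'v entry \<Rightarrow> ereal" where
  "entry_score s e = (case e of None \<Rightarrow> -\<infinity> | Some z \<Rightarrow> ereal (s z))"

definition dataset_entries :: "'v doc set \<Rightarrow> 'v entry multiset" where
  "dataset_entries D = image_mset Some (mset_set D)"

text \<open>
  The entries in order of decreasing score.  If \<open>s\<close> has no ties, there is exactly one such list.
\<close>

definition ranked :: "('v doc \<Rightarrow> real) \<Rightarrow> 'v entry multiset \<Rightarrow> 'v entry list" where
  "ranked s E =
     (SOME es. mset es = E \<and> sorted_wrt (\<lambda>e e'. entry_score s e \<ge> entry_score s e') es)"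

definition top_k :: "'v entry multiset \<Rightarrow> nat \<Rightarrow> ('v doc \<Rightarrow> real) \<Rightarrow> 'v entry list" where
  "top_k E K s =
     (if size E \<ge> K then take K (ranked s E)
      else ranked s E @ replicate (K - size E) None)"

record 'v rag =
  relevance :: "'v doc \<Rightarrow> 'v list \<Rightarrow> real"  \<comment> \<open>document, query\<close>
  llm :: "'v list \<Rightarrow> 'v doc multiset \<Rightarrow> 'v list \<Rightarrow> 'v"  \<comment> \<open>prompt, context, tokens so far\<close>
  eos :: 'v
  token_budget :: real
  max_tokens :: nat
  voters :: nat
  docs_per_voter :: nat
  vote_threshold :: real

definition eps_lap :: "'v rag \<Rightarrow> real" where
  "eps_lap P = token_budget P / 2"

definition eps_expo :: "'v rag \<Rightarrow> real" where
  "eps_expo P = token_budget P / 2"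

text \<open>
  A split of \<open>m * k'\<close> positions into \<open>m\<close> labelled chunks of size \<open>k'\<close> is a map from positions to
  chunk numbers all of whose fibres have \<open>k'\<close> elements.
\<close>

definition splits :: "nat \<Rightarrow> nat \<Rightarrow> (nat \<Rightarrow> nat) set" where
  "splits m k' = {f \<in> {..<m * k'} \<rightarrow>\<^sub>E {..<m}. \<forall>i<m. card {j. j < m * k' \<and> f j = i} = k'}"

definition chunk :: "'v entry list \<Rightarrow> (nat \<Rightarrow> nat) \<Rightarrow> nat \<Rightarrow> 'v doc multiset" where
  "chunk es f i = image_mset (\<lambda>j. entry_text (es ! j)) (mset_set {j. j < length es \<and> f j = i})"

definition votes ::
    "'v rag \<Rightarrow> 'v list \<Rightarrow> (nat \<Rightarrow> 'v doc multiset) \<Rightarrow> 'v list \<Rightarrow> 'v \<Rightarrow> nat" where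
  "votes P x C ys v = card {i. i < voters P \<and> llm P x (C i) ys = v}"

definition noisy_threshold :: "'v rag \<Rightarrow> real measure" where
  "noisy_threshold P =
     distr (laplace (2 / eps_lap P)) borel (\<lambda>\<eta>. vote_threshold P + \<eta>)"

text \<open>
  The token loop.  Arguments: number of iterations left, number \<open>c\<close> of discoveries left, current
  noisy threshold, tokens generated so far.
\<close>

primrec dprag_loop ::
    "'v::finite rag \<Rightarrow> 'v list \<Rightarrow> (nat \<Rightarrow> 'v doc multiset) \<Rightarrow>
       nat \<Rightarrow> nat \<Rightarrow> real \<Rightarrow> 'v list \<Rightarrow> 'v list measure" where
  "dprag_loop P x C 0 c \<theta>' ys = return (count_space UNIV) ys"
| "dprag_loop P x C (Suc n) c \<theta>' ys =
     (let b = llm P x {#} ys; u = votes P x C ys in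
      do {
        \<xi> \<leftarrow> laplace (4 / eps_lap P);
        if real (u b) + \<xi> \<le> \<theta>' then
          do {
            y \<leftarrow> measure_pmf (exponential_mechanism (eps_expo P) u);
            \<theta>'' \<leftarrow> noisy_threshold P;
            if y = eos P \<or> c - 1 = 0 then return (count_space UNIV) (ys @ [y])
            else dprag_loop P x C n (c - 1) \<theta>'' (ys @ [y])
          }
        else
          (if b = eos P \<or> c = 0 then return (count_space UNIV) (ys @ [b])
           else dprag_loop P x C n c \<theta>' (ys @ [b]))
      })"

definition dprag :: "'v::finite rag \<Rightarrow> 'v list \<Rightarrow> 'v entry multiset \<Rightarrow> real \<Rightarrow> 'v list measure" where
  "dprag P x E \<epsilon> =
     (let c = nat \<lfloor>\<epsilon> / token_budget P\<rfloor>;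
          es = top_k E (voters P * docs_per_voter P) (\<lambda>z. relevance P z x) in
      if c = 0 then return (count_space UNIV) []
      else
        do {
          \<theta>' \<leftarrow> noisy_threshold P;
          f \<leftarrow> measure_pmf (pmf_of_set (splits (voters P) (docs_per_voter P)));
          dprag_loop P x (chunk es f) (max_tokens P) c \<theta>' []
        })"

text \<open>
  \<open>B z\<close> is the remaining budget of document \<open>z\<close>; only its values on the dataset \<open>D\<close> matter.
\<close>

primrec murag_from ::
    "'v::finite rag \<Rightarrow> nat \<Rightarrow> real \<Rightarrow> real \<Rightarrow> 'v doc set \<Rightarrow>
       'v list list \<Rightarrow> ('v doc \<Rightarrow> real) \<Rightarrow> 'v list list measure" where
  "murag_from P k \<epsilon>\<^sub>q \<tau> D [] B = return (count_space UNIV) []"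
| "murag_from P k \<epsilon>\<^sub>q \<tau> D (q # qs) B =
     (let A = {z \<in> D. B z \<ge> \<epsilon>\<^sub>q};
          Dq = {z \<in> A. relevance P z q > \<tau>};
          B' = (\<lambda>z. if z \<in> Dq then B z - \<epsilon>\<^sub>q else B z);
          Dqk = top_k (dataset_entries Dq) k (\<lambda>z. relevance P z q) in
      do {
        a \<leftarrow> dprag P q (mset Dqk) \<epsilon>\<^sub>q;
        as \<leftarrow> murag_from P k \<epsilon>\<^sub>q \<tau> D qs B';
        return (count_space UNIV) (a # as)
      })"

definition initial_budget :: "nat \<Rightarrow> real \<Rightarrow> 'v doc \<Rightarrow> real" where
  "initial_budget M \<epsilon>\<^sub>q z = real M * \<epsilon>\<^sub>q"

definition murag ::
    "'v::finite rag \<Rightarrow> nat \<Rightarrow> nat \<Rightarrow> real \<Rightarrow> real \<Rightarrow> 'v list list \<Rightarrow>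
       'v doc set \<Rightarrow> 'v list list measure" where
  "murag P k M \<epsilon>\<^sub>q \<tau> qs D = murag_from P k \<epsilon>\<^sub>q \<tau> D qs (initial_budget M \<epsilon>\<^sub>q)"

end

theory Submission
  imports Defs
begin

text \<open>
  Whether a document \<open>z\<close> is retrieved for a query depends on \<open>z\<close>, its own budget and the query only,
  so adding \<open>z\<close> to the dataset changes the input of at most as many calls of \<^const>\<open>dprag\<close> as the
  budget of \<open>z\<close> can pay for, each of them at cost \<open>\<epsilon>\<^sub>q\<close>.  In such a call the two nested top-\<open>K\<close>
  selections differ by the substitution of one entry; a permutation of the positions couples the
  random splits so that a single chunk, hence a single vote, changes.  The token loop is then a
  sequence of at most \<open>\<lfloor>\<epsilon>\<^sub>q / \<epsilon>\<^sub>0\<rfloor>\<close> runs of the sparse vector technique: shifting the noisy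
  threshold by 1 makes every non-discovery free, and shifting the noise of the discovery by 2 pays
  for the test, so each run costs \<open>\<epsilon>\<^sub>0 / 2\<close> plus the \<open>\<epsilon>\<^sub>0 / 2\<close> of the exponential mechanism.
\<close>

section \<open>One-sided indistinguishability\<close>

text \<open>One direction only, since the couplings below move noise one way; privacy needs the
  relation both ways round. With \<open>emeasure\<close> no finiteness conditions arise, and
  equality of \<open>sets\<close> is included so that the relation composes.\<close>

definition dp_le :: "real \<Rightarrow> 'a measure \<Rightarrow> 'a measure \<Rightarrow> bool" where
  "dp_le e M N \<longleftrightarrow>
     sets M = sets N \<and> (\<forall>S\<in>sets M. emeasure M S \<le> ennreal (exp e) * emeasure N S)"

lemma dp_le_mono:
  assumes "dp_le e M N" "e \<le> e'"
  shows "dp_le e' M N"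
  using assms unfolding dp_le_def
  by (meson ennreal_leI exp_le_cancel_iff mult_right_mono order_trans zero_le)

lemma dp_le_refl: "0 \<le> e \<Longrightarrow> dp_le e M M"
  by (rule dp_le_mono[of 0]) (auto simp: dp_le_def)

lemma dp_le_trans:
  assumes "dp_le d N R" "dp_le e M N"
  shows "dp_le (d + e) M R"
  unfolding dp_le_def
proof (intro conjI ballI)
  fix S assume "S \<in> sets M"
  hence "emeasure M S \<le> ennreal (exp e) * emeasure N S"
    "emeasure N S \<le> ennreal (exp d) * emeasure R S"
    using assms by (auto simp: dp_le_def)
  hence "emeasure M S \<le> ennreal (exp e) * (ennreal (exp d) * emeasure R S)"
    by (meson mult_left_mono order_trans zero_le)
  thus "emeasure M S \<le> ennreal (exp (d + e)) * emeasure R S"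
    by (simp add: exp_add ennreal_mult mult_ac)
qed (use assms in \<open>auto simp: dp_le_def\<close>)

text \<open>The bound on all sets places \<open>M\<close> below the scaled copy of \<open>N\<close>
  in the order of measures, and the integral is monotone in the measure.\<close>

lemma dp_le_nn_integral:
  assumes "dp_le e M N" and "f \<in> borel_measurable N"
  shows "(\<integral>\<^sup>+x. f x \<partial>M) \<le> ennreal (exp e) * (\<integral>\<^sup>+x. f x \<partial>N)"
proof -
  have "M \<le> scale_measure (ennreal (exp e)) N"
    using assms by (subst le_measure) (auto simp: dp_le_def)
  hence "nn_integral M f \<le> nn_integral (scale_measure (ennreal (exp e)) N) f"
    using assms by (intro nn_integral_mono_measure) (auto simp: dp_le_def)
  thus ?thesis using assms by (simp add: nn_integral_scale_measure dp_le_def)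
qed

text \<open>Adaptive composition: the bound between the kernels is integrated against
  \<open>M\<close>, then \<open>M\<close> is exchanged for \<open>N\<close> under the
  integral.\<close>

lemma dp_le_bind:
  assumes M: "M \<in> space (prob_algebra A)" and N: "N \<in> space (prob_algebra A)"
    and f: "f \<in> A \<rightarrow>\<^sub>M prob_algebra B" and g: "g \<in> A \<rightarrow>\<^sub>M prob_algebra B"
    and MN: "dp_le d M N" and fg: "\<And>x. x \<in> space A \<Longrightarrow> dp_le e (f x) (g x)"
  shows "dp_le (d + e) (M \<bind> f) (N \<bind> g)"
proof -
  have sM: "sets M = sets A" "sets N = sets A" and sp: "space M = space A" "space N = space A"
    using M N by (auto simp: space_prob_algebra dest: sets_eq_imp_space_eq)
  note sb = sets_bind'[OF M f] sets_bind'[OF N g]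
  have "emeasure (M \<bind> f) S \<le> ennreal (exp (d + e)) * emeasure (N \<bind> g) S" if S: "S \<in> sets B" for S
  proof -
    have sf: "sets (f x) = sets B" if "x \<in> space A" for x
      using measurable_space[OF f that] by (simp add: space_prob_algebra)
    have mg: "(\<lambda>x. emeasure (g x) S) \<in> borel_measurable A"
      using measurable_compose[OF measurable_prob_algebraD[OF g] measurable_emeasure_subprob_algebra[OF S]] .
    have "emeasure (M \<bind> f) S = (\<integral>\<^sup>+x. emeasure (f x) S \<partial>M)"
      using M f S by (rule emeasure_bind_prob_algebra)
    also have "\<dots> \<le> (\<integral>\<^sup>+x. ennreal (exp e) * emeasure (g x) S \<partial>M)"
      using fg sf S by (intro nn_integral_mono) (auto simp: sp dp_le_def)
    also have "\<dots> = ennreal (exp e) * (\<integral>\<^sup>+x. emeasure (g x) S \<partial>M)"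
      using mg by (intro nn_integral_cmult) (simp cong: measurable_cong_sets add: sM)
    also have "\<dots> \<le> ennreal (exp e) * (ennreal (exp d) * (\<integral>\<^sup>+x. emeasure (g x) S \<partial>N))"
      using mg by (intro mult_left_mono dp_le_nn_integral MN) (auto cong: measurable_cong_sets simp: sM)
    also have "\<dots> = ennreal (exp (d + e)) * emeasure (N \<bind> g) S"
      using emeasure_bind_prob_algebra[OF N g S]
      by (simp add: exp_add ennreal_mult mult_ac)
    finally show ?thesis .
  qed
  thus ?thesis by (auto simp: dp_le_def sb)
qed

text \<open>Coupling of noise: a draw \<open>x\<close> in the first run is matched with
  \<open>s x\<close> in the second, and \<open>d\<close> is the price of moving the law
  \<open>N\<close> along \<open>s\<close>.\<close>

lemma dp_le_bind_shift:
  assumes N: "N \<in> space (prob_algebra A)" and s: "s \<in> A \<rightarrow>\<^sub>M A"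
    and f: "f \<in> A \<rightarrow>\<^sub>M prob_algebra B" and g: "g \<in> A \<rightarrow>\<^sub>M prob_algebra B"
    and shift: "dp_le d (distr N A s) N"
    and fg: "\<And>x. x \<in> space A \<Longrightarrow> dp_le e (f x) (g (s x))"
  shows "dp_le (d + e) (N \<bind> f) (N \<bind> g)"
proof -
  have sN: "sets N = sets A" and pN: "prob_space N" using N by (auto simp: space_prob_algebra)
  have [measurable]: "s \<in> N \<rightarrow>\<^sub>M A" using s by (simp cong: measurable_cong_sets add: sN)
  have gs: "(\<lambda>x. g (s x)) \<in> A \<rightarrow>\<^sub>M prob_algebra B" using s g by simp
  have D: "distr N A s \<in> space (prob_algebra A)"
    using pN by (auto simp: space_prob_algebra intro!: prob_space.prob_space_distr)
  have 1: "distr N A s \<bind> g = N \<bind> (\<lambda>x. g (s x))"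
    by (rule bind_distr[OF _ measurable_prob_algebraD[OF g]]) (use pN in \<open>auto dest: prob_space.not_empty\<close>)
  have "dp_le e (N \<bind> f) (N \<bind> (\<lambda>x. g (s x)))"
    using dp_le_bind[OF N N f gs dp_le_refl[of 0] fg] by simp
  moreover have "dp_le d (N \<bind> (\<lambda>x. g (s x))) (N \<bind> g)"
    using dp_le_bind[OF D N g g shift dp_le_refl[of 0]] 1 by simp
  ultimately show ?thesis by (intro dp_le_trans)
qed

section \<open>Laplace noise: shifts and noisy comparisons\<close>

lemma sets_laplace [simp, measurable_cong]: "sets (laplace b) = sets borel"
  by (simp add: laplace_def)

lemma space_laplace [simp]: "space (laplace b) = UNIV"
  by (simp add: laplace_def)

text \<open>The Laplace law is the equal mixture of the exponential law of rate \<open>1 / b\<close>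
  and its reflection, so its mass comes from that of the exponential law.\<close>

lemma prob_space_laplace:
  assumes b: "b > 0"
  shows "prob_space (laplace b)"
proof
  let ?f = "\<lambda>x. ennreal (exponential_density (1 / b) x)"
  have E: "(\<integral>\<^sup>+x. ?f x \<partial>lborel) = 1"
    using prob_space.emeasure_space_1[OF prob_space_exponential_density[of "1/b"]] b
    by (simp add: emeasure_density)
  hence E': "(\<integral>\<^sup>+x. ?f (- x) \<partial>lborel) = 1"
    using nn_integral_real_affine[of ?f "-1" 0] by simp
  have "emeasure (laplace b) (space (laplace b)) =
      (\<integral>\<^sup>+x. ennreal (exp (- \<bar>x\<bar> / b) / (2 * b)) \<partial>lborel)"
    by (simp add: laplace_def emeasure_density)
  also have "\<dots> = (\<integral>\<^sup>+x. ennreal (1/2) * (?f x + ?f (- x)) \<partial>lborel)"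
  proof (rule nn_integral_cong_AE)
    \<comment> \<open>At 0 both halves are positive and the right-hand side is twice the left, hence
      an identity only almost everywhere.\<close>
    show "AE x in lborel. ennreal (exp (- \<bar>x\<bar> / b) / (2 * b)) = ennreal (1/2) * (?f x + ?f (- x))"
      using AE_lborel_singleton[of 0]
    proof eventually_elim
      case (elim x)
      have "exp (- \<bar>x\<bar> / b) / (2 * b) =
          1/2 * (exponential_density (1 / b) x + exponential_density (1 / b) (- x))"
        using b elim by (auto simp: exponential_density_def)
      moreover have "exponential_density (1 / b) y \<ge> 0" for y
        using b by (simp add: exponential_density_def)
      ultimately show ?case
        by (simp only: ennreal_mult ennreal_plus add_nonneg_nonneg zero_le_divide_1_iff zero_le_numeral)
    qed
  qed
  also have "\<dots> = ennreal (1/2) * (1 + 1)"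
    by (simp add: nn_integral_cmult nn_integral_add E E')
  also have "\<dots> = 1"
    by (metis ennreal_1 ennreal_plus ennreal_mult field_sum_of_halves le_numeral_extra(1) mult.commute mult_2 mult.right_neutral zero_le_divide_1_iff zero_le_numeral)
  finally show "emeasure (laplace b) (space (laplace b)) = 1" .
qed

lemma laplace_in_prob_algebra: "b > 0 \<Longrightarrow> laplace b \<in> space (prob_algebra borel)"
  by (simp add: space_prob_algebra prob_space_laplace)

text \<open>By the triangle inequality the density at \<open>x - d\<close> is at most
  \<open>exp (\<bar>d\<bar> / b)\<close> times the density at \<open>x\<close>.\<close>

lemma dp_le_laplace_shift:
  assumes b: "b > 0"
  shows "dp_le (\<bar>d\<bar> / b) (distr (laplace b) borel (\<lambda>x. x + d)) (laplace b)"
  unfolding dp_le_def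
proof (intro conjI ballI)
  fix S assume "S \<in> sets (distr (laplace b) borel (\<lambda>x. x + d))"
  hence S[measurable]: "S \<in> sets borel" by simp
  let ?g = "\<lambda>x. ennreal (exp (- \<bar>x\<bar> / b) / (2 * b))"
  have "emeasure (distr (laplace b) borel (\<lambda>x. x + d)) S =
      (\<integral>\<^sup>+x. ?g x * indicator S (x + d) \<partial>lborel)"
    by (subst emeasure_distr)
       (auto simp: laplace_def emeasure_density indicator_def measurable_sets_borel[of "\<lambda>x. x + d", OF _ S]
             intro!: nn_integral_cong)
  also have "\<dots> = (\<integral>\<^sup>+x. ?g (x - d) * indicator S x \<partial>lborel)"
    using nn_integral_real_affine[of "\<lambda>x. ?g (x - d) * indicator S x" 1 d] by (simp add: add.commute)
  also have "\<dots> \<le> (\<integral>\<^sup>+x. ennreal (exp (\<bar>d\<bar> / b)) * (?g x * indicator S x) \<partial>lborel)"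
  proof (intro nn_integral_mono)
    fix x
    have "- \<bar>x - d\<bar> / b \<le> \<bar>d\<bar> / b + - \<bar>x\<bar> / b"
      using b by (simp add: field_simps)
    hence "exp (- \<bar>x - d\<bar> / b) \<le> exp (\<bar>d\<bar> / b) * exp (- \<bar>x\<bar> / b)"
      by (simp flip: exp_add)
    hence "?g (x - d) \<le> ennreal (exp (\<bar>d\<bar> / b)) * ?g x"
      using b by (subst ennreal_mult[symmetric]) (auto intro!: ennreal_leI simp: field_simps)
    thus "?g (x - d) * indicator S x \<le> ennreal (exp (\<bar>d\<bar> / b)) * (?g x * indicator S x)"
      by (auto simp: indicator_def)
  qed
  also have "\<dots> = ennreal (exp (\<bar>d\<bar> / b)) * emeasure (laplace b) S"
    by (simp add: nn_integral_cmult laplace_def emeasure_density)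
  finally show "emeasure (distr (laplace b) borel (\<lambda>x. x + d)) S
      \<le> ennreal (exp (\<bar>d\<bar> / b)) * emeasure (laplace b) S" .
qed simp

text \<open>The branches do not add up: lowering the threshold only enlarges the upper event, so
  that branch may spend all of \<open>s / b + e\<close> on its continuation, while the lower branch
  pays \<open>s / b\<close> for the comparison and \<open>e\<close> for what follows.\<close>

lemma dp_le_laplace_test:
  assumes b: "b > 0" and t: "t' \<le> t" "t - s \<le> t'"
    and e: "0 \<le> e" and B: "F \<in> space (prob_algebra B)" "G \<in> space (prob_algebra B)"
      "F' \<in> space (prob_algebra B)" "G' \<in> space (prob_algebra B)"
    and F: "dp_le e F F'" and G: "dp_le (s / b + e) G G'"
  shows "dp_le (s / b + e) (laplace b \<bind> (\<lambda>\<xi>. if \<xi> \<le> t then F else G))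
           (laplace b \<bind> (\<lambda>\<xi>. if \<xi> \<le> t' then F' else G'))"
proof -
  let ?L = "laplace b"
  have m: "(\<lambda>\<xi>. if \<xi> \<le> u then X else Y) \<in> borel \<rightarrow>\<^sub>M prob_algebra B"
    if [measurable]: "X \<in> space (prob_algebra B)" "Y \<in> space (prob_algebra B)" for X Y and u :: real
    by measurable
  have em: "emeasure (?L \<bind> (\<lambda>\<xi>. if \<xi> \<le> u then X else Y)) S =
      emeasure X S * emeasure ?L {..u} + emeasure Y S * emeasure ?L {u<..}"
    if XY: "X \<in> space (prob_algebra B)" "Y \<in> space (prob_algebra B)" and S: "S \<in> sets B" for X Y S u
  proof -
    have "emeasure (?L \<bind> (\<lambda>\<xi>. if \<xi> \<le> u then X else Y)) S =
      (\<integral>\<^sup>+\<xi>. emeasure (if \<xi> \<le> u then X else Y) S \<partial>?L)"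
      using laplace_in_prob_algebra[OF b] m[OF XY] S by (rule emeasure_bind_prob_algebra)
    also have "\<dots> = (\<integral>\<^sup>+\<xi>. emeasure X S * indicator {..u} \<xi> + emeasure Y S * indicator {u<..} \<xi> \<partial>?L)"
      by (intro nn_integral_cong) (auto simp: indicator_def)
    finally show ?thesis by (simp add: nn_integral_add nn_integral_cmult)
  qed
  have sb: "sets (?L \<bind> (\<lambda>\<xi>. if \<xi> \<le> u then X else Y)) = sets B"
    if XY: "X \<in> space (prob_algebra B)" "Y \<in> space (prob_algebra B)" for X Y u
    using that by (intro sets_bind) (auto simp: space_prob_algebra laplace_def)
  have s0: "0 \<le> s" using t by simp
  \<comment> \<open>Moving the noise down by \<open>s\<close> carries the event \<open>{..t}\<close>
    to \<open>{..t - s}\<close>, which lies inside \<open>{..t'}\<close>.\<close>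
  have below: "emeasure ?L {..t} \<le> ennreal (exp (s / b)) * emeasure ?L {..t'}"
  proof -
    have "emeasure ?L {..t} = emeasure (distr ?L borel (\<lambda>x. x + - s)) {..t - s}"
      by (subst emeasure_distr) (auto simp: vimage_def laplace_def atMost_def)
    also have "\<dots> \<le> ennreal (exp (s / b)) * emeasure ?L {..t - s}"
      using dp_le_laplace_shift[OF b, of "- s"] s0 by (auto simp: dp_le_def)
    also have "\<dots> \<le> ennreal (exp (s / b)) * emeasure ?L {..t'}"
      using t by (intro mult_left_mono emeasure_mono) auto
    finally show ?thesis .
  qed
  have above: "emeasure ?L {t<..} \<le> emeasure ?L {t'<..}"
    using t by (intro emeasure_mono) auto
  show ?thesis
    unfolding dp_le_def
  proof (intro conjI ballI)
    fix S assume "S \<in> sets (?L \<bind> (\<lambda>\<xi>. if \<xi> \<le> t then F else G))"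
    hence S: "S \<in> sets B" using sb B by simp
    have "emeasure F S \<le> ennreal (exp e) * emeasure F' S"
      "emeasure G S \<le> ennreal (exp (s / b + e)) * emeasure G' S"
      using F G S B by (auto simp: dp_le_def space_prob_algebra)
    hence "emeasure F S * emeasure ?L {..t} + emeasure G S * emeasure ?L {t<..} \<le>
      (ennreal (exp e) * emeasure F' S) * (ennreal (exp (s / b)) * emeasure ?L {..t'}) +
      (ennreal (exp (s / b + e)) * emeasure G' S) * emeasure ?L {t'<..}"
      using below above by (intro add_mono mult_mono) auto
    also have "\<dots> = ennreal (exp (s / b + e)) *
        (emeasure F' S * emeasure ?L {..t'} + emeasure G' S * emeasure ?L {t'<..})"
      by (simp add: exp_add ennreal_mult distrib_left mult_ac)
    finally show "emeasure (?L \<bind> (\<lambda>\<xi>. if \<xi> \<le> t then F else G)) S \<le> ennreal (exp (s / b + e)) *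
      emeasure (?L \<bind> (\<lambda>\<xi>. if \<xi> \<le> t' then F' else G')) S"
      using em B S by simp
  qed (use sb B in auto)
qed

section \<open>The exponential mechanism\<close>

lemma pmf_exponential_mechanism:
  "pmf (exponential_mechanism \<epsilon> u) v =
     exp (\<epsilon> * real (u v) / 2) / (\<Sum>w\<in>UNIV. exp (\<epsilon> * real (u w) / 2))"
proof -
  have pos: "(\<Sum>w\<in>UNIV. exp (\<epsilon> * real (u w) / 2)) > 0"
    by (intro sum_pos) auto
  show ?thesis
    unfolding exponential_mechanism_def
  proof (rule pmf_embed_pmf)
    have "(\<Sum>v\<in>UNIV. exp (\<epsilon> * real (u v) / 2) / (\<Sum>w\<in>UNIV. exp (\<epsilon> * real (u w) / 2))) = 1"
      using pos by (simp flip: sum_divide_distrib)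
    thus "(\<integral>\<^sup>+ v. ennreal (exp (\<epsilon> * real (u v) / 2) / (\<Sum>w\<in>UNIV. exp (\<epsilon> * real (u w) / 2)))
        \<partial>count_space UNIV) = 1"
      using pos by (simp add: nn_integral_count_space_finite sum_ennreal less_imp_le)
  qed (use pos in \<open>simp add: less_imp_le\<close>)
qed

text \<open>The weight of a token and the normalising sum each change by a factor of at most
  \<open>exp (\<epsilon> / 2)\<close>.\<close>

lemma dp_le_exponential_mechanism:
  assumes e: "\<epsilon> \<ge> 0" and u: "\<And>v. u v \<le> u' v + 1" "\<And>v. u' v \<le> u v + 1"
  shows "dp_le \<epsilon> (measure_pmf (exponential_mechanism \<epsilon> u)) (measure_pmf (exponential_mechanism \<epsilon> u'))"
proof -
  have step: "exp (\<epsilon> * real (a v) / 2) \<le> exp (\<epsilon> / 2) * exp (\<epsilon> * real (b v) / 2)"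
    if "\<And>v. a v \<le> b v + 1" for a b :: "'a \<Rightarrow> nat" and v
  proof -
    have "real (a v) \<le> real (b v) + 1" using that[of v] by linarith
    hence "\<epsilon> * real (a v) \<le> \<epsilon> * (real (b v) + 1)" using e by (rule mult_left_mono)
    thus ?thesis by (simp flip: exp_add add: field_simps)
  qed
  let ?Z = "\<lambda>u. \<Sum>w\<in>UNIV. exp (\<epsilon> * real (u w) / 2)"
  have pos: "?Z a > 0" for a :: "'a \<Rightarrow> nat" by (intro sum_pos) auto
  \<comment> \<open>The normaliser stands in the denominator, so the utilities have to be compared
    in the opposite direction.\<close>
  have Z: "?Z u' \<le> exp (\<epsilon> / 2) * ?Z u"
    unfolding sum_distrib_left by (intro sum_mono step u)
  have "pmf (exponential_mechanism \<epsilon> u) v \<le> exp \<epsilon> * pmf (exponential_mechanism \<epsilon> u') v" for v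
  proof -
    have "exp (\<epsilon> * real (u v) / 2) * ?Z u' \<le>
        (exp (\<epsilon> / 2) * exp (\<epsilon> * real (u' v) / 2)) * (exp (\<epsilon> / 2) * ?Z u)"
      using pos[of u'] Z by (intro mult_mono step u) auto
    also have "\<dots> = exp \<epsilon> * exp (\<epsilon> * real (u' v) / 2) * ?Z u"
      by (simp flip: exp_add add: mult_ac)
    finally show ?thesis
      using pos by (simp add: pmf_exponential_mechanism field_simps)
  qed
  note le = this
  show ?thesis
    unfolding dp_le_def
  proof (intro conjI ballI)
    fix S :: "'a set"
    have "emeasure (exponential_mechanism \<epsilon> u) S =
        (\<integral>\<^sup>+v. pmf (exponential_mechanism \<epsilon> u) v \<partial>count_space S)"
      by (rule nn_integral_pmf[symmetric])
    also have "\<dots> \<le> (\<integral>\<^sup>+v. ennreal (exp \<epsilon>) * pmf (exponential_mechanism \<epsilon> u') v \<partial>count_space S)"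
      using le by (intro nn_integral_mono) (auto simp flip: ennreal_mult intro!: ennreal_leI)
    also have "\<dots> = ennreal (exp \<epsilon>) * emeasure (exponential_mechanism \<epsilon> u') S"
      by (simp add: nn_integral_cmult nn_integral_pmf)
    finally show "emeasure (exponential_mechanism \<epsilon> u) S \<le>
        ennreal (exp \<epsilon>) * emeasure (exponential_mechanism \<epsilon> u') S" .
  qed simp
qed

section \<open>The token loop\<close>

lemma measure_pmf_in_prob_algebra: "measure_pmf p \<in> space (prob_algebra (count_space UNIV))"
  by (simp add: space_prob_algebra measure_pmf.prob_space_axioms)

lemma return_in_prob_algebra: "return (count_space UNIV) x \<in> space (prob_algebra (count_space UNIV))"
  by (simp add: space_prob_algebra prob_space_return)

lemma bind_in_prob_algebra:
  "M \<in> space (prob_algebra A) \<Longrightarrow> f \<in> A \<rightarrow>\<^sub>M prob_algebra B \<Longrightarrow> M \<bind> f \<in> space (prob_algebra B)"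
  by (simp add: space_prob_algebra prob_space_bind' sets_bind')

lemma noisy_threshold_in_prob_algebra:
  "token_budget P > 0 \<Longrightarrow> noisy_threshold P \<in> space (prob_algebra borel)"
  unfolding noisy_threshold_def
  by (auto simp: space_prob_algebra eps_lap_def intro!: prob_space.prob_space_distr prob_space_laplace)

text \<open>Moving Laplace noise of scale \<open>2 / eps_lap P\<close> by 1 costs
  \<open>eps_lap P / 2\<close>; adding \<open>vote_threshold P\<close> commutes with the
  move.\<close>

lemma dp_le_noisy_threshold_shift:
  assumes "token_budget P > 0"
  shows "dp_le (eps_lap P / 2) (distr (noisy_threshold P) borel (\<lambda>x. x - 1)) (noisy_threshold P)"
proof -
  let ?L = "laplace (2 / eps_lap P)" and ?g = "\<lambda>\<eta>. vote_threshold P + \<eta>"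
  have "dp_le (eps_lap P / 2) (distr ?L borel (\<lambda>x. x + - 1)) ?L"
    using dp_le_laplace_shift[of "2 / eps_lap P" "- 1"] assms by (simp add: eps_lap_def)
  hence "emeasure (distr ?L borel (\<lambda>x. x + - 1)) (?g -` S) \<le>
      ennreal (exp (eps_lap P / 2)) * emeasure ?L (?g -` S)" if "S \<in> sets borel" for S
    using measurable_sets_borel[of ?g borel S] that by (auto simp: dp_le_def)
  thus ?thesis
    by (auto simp: dp_le_def noisy_threshold_def emeasure_distr distr_distr comp_def vimage_def
          measurable_sets_borel algebra_simps)
qed

lemma measurable_dprag_loop:
  assumes "token_budget P > 0"
  shows "(\<lambda>\<theta>. dprag_loop P x C n c \<theta> ys) \<in> borel \<rightarrow>\<^sub>M prob_algebra (count_space UNIV)"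
proof (induction n arbitrary: c ys)
  case 0
  show ?case by (simp add: return_in_prob_algebra)
next
  case (Suc n)
  note [measurable] = Suc.IH
  let ?b = "llm P x {#} ys"
  note [measurable] = laplace_in_prob_algebra noisy_threshold_in_prob_algebra[OF assms]
  let ?F = "measure_pmf (exponential_mechanism (eps_expo P) (votes P x C ys)) \<bind> (\<lambda>y.
      noisy_threshold P \<bind> (\<lambda>\<theta>.
      if y = eos P \<or> c - 1 = 0 then return (count_space UNIV) (ys @ [y])
      else dprag_loop P x C n (c - 1) \<theta> (ys @ [y])))"
  have [measurable]: "?F \<in> space (prob_algebra (count_space UNIV))"
    by (intro bind_in_prob_algebra[OF measure_pmf_in_prob_algebra])
       (auto intro!: bind_in_prob_algebra[OF noisy_threshold_in_prob_algebra[OF assms]] measurable_If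
             simp: return_in_prob_algebra Suc.IH)
  have [measurable]: "laplace (4 / eps_lap P) \<in> space (prob_algebra borel)"
    using assms by (simp add: laplace_in_prob_algebra eps_lap_def)
  have [measurable]: "return (count_space UNIV) (ys @ [?b]) \<in> space (prob_algebra (count_space UNIV))"
    by (rule return_in_prob_algebra)
  show ?case
    unfolding dprag_loop.simps Let_def
    by measurable
qed


text \<open>
  The missing \<open>eps_lap P / 2\<close> is the price of shifting the current threshold by 1, which is charged
  where that threshold is drawn.
\<close>

lemma dp_le_dprag_loop:
  fixes P :: "'v::finite rag"
  assumes tb: "token_budget P > 0"
    and V: "\<And>ys v. votes P x C ys v \<le> votes P x C' ys v + 1"
      "\<And>ys v. votes P x C' ys v \<le> votes P x C ys v + 1"
    and c: "c \<ge> 1"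
  shows "dp_le (real c * token_budget P - eps_lap P / 2)
           (dprag_loop P x C n c \<theta> ys) (dprag_loop P x C' n c (\<theta> - 1) ys)"
  using c
proof (induction n arbitrary: c \<theta> ys)
  case 0
  \<comment> \<open>Because \<open>c\<close> is at least 1, the bound stays nonnegative after
    \<open>eps_lap P / 2\<close> is subtracted.\<close>
  have "token_budget P \<le> real c * token_budget P" using 0 tb by simp
  thus ?case using tb by (simp add: dp_le_refl eps_lap_def)
next
  case (Suc n)
  let ?pr = "prob_algebra (count_space (UNIV :: 'v list set))"
  let ?b = "llm P x {#} ys" and ?u = "\<lambda>C. votes P x C ys"
  have ge: "token_budget P \<le> real c * token_budget P" using Suc.prems tb by simp
  \<comment> \<open>\<open>K\<close> is the continuation after the token \<open>y\<close> of a
    discovery, as a function of the redrawn threshold; \<open>F\<close> is the whole discovery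
    branch and \<open>G\<close> the branch without a discovery.\<close>
  define K where "K C y = (\<lambda>\<theta>. if y = eos P \<or> c - 1 = 0 then return (count_space UNIV) (ys @ [y])
      else dprag_loop P x C n (c - 1) \<theta> (ys @ [y]))" for C y
  define F where "F C = measure_pmf (exponential_mechanism (eps_expo P) (?u C)) \<bind>
      (\<lambda>y. noisy_threshold P \<bind> K C y)" for C
  define G where "G C \<theta> = (if ?b = eos P \<or> c = 0 then return (count_space UNIV) (ys @ [?b])
      else dprag_loop P x C n c \<theta> (ys @ [?b]))" for C \<theta>
  note NT = noisy_threshold_in_prob_algebra[OF tb]
  have Km: "K C y \<in> borel \<rightarrow>\<^sub>M ?pr" for C y
    unfolding K_def using measurable_dprag_loop[OF tb]
    by (cases "y = eos P \<or> c - 1 = 0") (auto simp: return_in_prob_algebra)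
  have Km': "(\<lambda>y. noisy_threshold P \<bind> K C y) \<in> count_space UNIV \<rightarrow>\<^sub>M ?pr" for C
    using bind_in_prob_algebra[OF NT Km] by auto
  have Fs: "F C \<in> space ?pr" for C
    unfolding F_def by (intro bind_in_prob_algebra[OF measure_pmf_in_prob_algebra] Km')
  have Gs: "G C \<theta> \<in> space ?pr" for C \<theta>
    unfolding G_def using measurable_space[OF measurable_dprag_loop[OF tb]]
    by (simp add: return_in_prob_algebra)
  have loop: "dprag_loop P x C (Suc n) c \<theta> ys = laplace (4 / eps_lap P) \<bind>
      (\<lambda>\<xi>. if \<xi> \<le> \<theta> - real (?u C ?b) then F C else G C \<theta>)" for C \<theta>
  proof -
    have "(real m + \<xi> \<le> \<theta>) \<longleftrightarrow> (\<xi> \<le> \<theta> - real m)" for m \<xi> by linarith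
    thus ?thesis by (simp only: dprag_loop.simps Let_def F_def G_def K_def)
  qed
  \<comment> \<open>The price of what follows a positive test: one exponential mechanism and
    \<open>c - 1\<close> further discoveries. The test itself adds
    \<open>2 / (4 / eps_lap P)\<close>, for moving its noise by 2.\<close>
  let ?e = "eps_expo P + real (c - 1) * token_budget P"
  have e: "2 / (4 / eps_lap P) + ?e = real c * token_budget P - eps_lap P / 2"
    using Suc.prems by (simp add: eps_lap_def eps_expo_def of_nat_diff algebra_simps)
  have FF: "dp_le ?e (F C) (F C')"
    unfolding F_def
  proof (rule dp_le_bind[OF measure_pmf_in_prob_algebra measure_pmf_in_prob_algebra Km' Km'])
    show "dp_le (eps_expo P) (measure_pmf (exponential_mechanism (eps_expo P) (?u C)))
        (measure_pmf (exponential_mechanism (eps_expo P) (?u C')))"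
      using V tb by (intro dp_le_exponential_mechanism) (auto simp: eps_expo_def)
    show "dp_le (real (c - 1) * token_budget P) (noisy_threshold P \<bind> K C y) (noisy_threshold P \<bind> K C' y)" for y
    proof (cases "y = eos P \<or> c - 1 = 0")
      case True
      hence "K C y = K C' y" by (auto simp: K_def)
      thus ?thesis using tb by (simp add: dp_le_refl)
    next
      case False
      \<comment> \<open>The new threshold is coupled with its copy lowered by 1; this pays the
        \<open>eps_lap P / 2\<close> that the induction hypothesis leaves out.\<close>
      have "dp_le (eps_lap P / 2 + (real (c - 1) * token_budget P - eps_lap P / 2))
          (noisy_threshold P \<bind> K C y) (noisy_threshold P \<bind> K C' y)"
      proof (rule dp_le_bind_shift[OF NT _ Km Km dp_le_noisy_threshold_shift[OF tb]])
        show "dp_le (real (c - 1) * token_budget P - eps_lap P / 2) (K C y t) (K C' y (t - 1))" for t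
          using False Suc.IH[of "c - 1" t "ys @ [y]"] by (auto simp: K_def)
      qed simp
      thus ?thesis by simp
    qed
  qed
  \<comment> \<open>Without a discovery \<open>c\<close> and the offset of 1 between the thresholds
    persist, so the induction hypothesis gives the same bound again: the token is free.\<close>
  have GG: "dp_le (2 / (4 / eps_lap P) + ?e) (G C \<theta>) (G C' (\<theta> - 1))"
    unfolding e G_def using Suc ge tb by (auto simp: dp_le_refl eps_lap_def)
  have uu: "real (?u C ?b) \<le> real (?u C' ?b) + 1" "real (?u C' ?b) \<le> real (?u C ?b) + 1"
    using V[of ys ?b] by linarith+
  \<comment> \<open>The test lemma is used with \<open>s = 2\<close>: the votes for the baseline
    token differ by at most 1 and the thresholds by exactly 1, so the difference of the bounds on
    the noise lies between 0 and 2.\<close>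
  show ?case
    unfolding loop e[symmetric] using tb uu
    by (intro dp_le_laplace_test[OF _ _ _ _ Fs Gs Fs Gs FF GG]) (auto simp: eps_lap_def eps_expo_def)
qed

section \<open>Top-K selection and random splits\<close>

text \<open>The choice in \<open>ranked\<close> has a witness: any enumeration of \<open>E\<close>,
  sorted by score and reversed.\<close>

lemma
  shows mset_ranked: "mset (ranked s E) = E"
    and sorted_ranked: "sorted_wrt (\<lambda>e e'. entry_score s e \<ge> entry_score s e') (ranked s E)"
proof -
  obtain xs where xs: "mset xs = E" using ex_mset by blast
  have "sorted (map (entry_score s) (sort_key (entry_score s) xs))"
    by simp
  hence "sorted_wrt (\<lambda>e e'. entry_score s e \<ge> entry_score s e') (rev (sort_key (entry_score s) xs))"
    by (simp only: sorted_wrt_rev sorted_wrt_map)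
  hence "\<exists>es. mset es = E \<and> sorted_wrt (\<lambda>e e'. entry_score s e \<ge> entry_score s e') es"
    using xs by (intro exI[of _ "rev (sort_key (entry_score s) xs)"]) simp
  from someI_ex[OF this] show "mset (ranked s E) = E"
    "sorted_wrt (\<lambda>e e'. entry_score s e \<ge> entry_score s e') (ranked s E)"
    unfolding ranked_def by auto
qed

lemma inj_entry_score: "inj s \<Longrightarrow> inj (entry_score s)"
  by (auto simp: inj_on_def entry_score_def split: option.splits)

text \<open>Sorting determines the list of scores, and an injective score determines the
  entries.\<close>

lemma ranked_unique:
  assumes s: "inj s" and "sorted_wrt (\<lambda>e e'. entry_score s e \<ge> entry_score s e') es"
  shows "ranked s (mset es) = es"
proof -
  have "map (entry_score s) xs = rev (sort (map (entry_score s) es))"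
    if "sorted_wrt (\<lambda>e e'. entry_score s e \<ge> entry_score s e') xs" "mset xs = mset es" for xs
  proof -
    have "sorted (rev (map (entry_score s) xs))"
      using that(1) by (simp add: sorted_wrt_rev sorted_wrt_map)
    moreover have "mset (rev (map (entry_score s) xs)) = mset (map (entry_score s) es)"
      using that(2) by simp
    ultimately show ?thesis
      by (metis properties_for_sort rev_rev_ident)
  qed
  hence "map (entry_score s) (ranked s (mset es)) = map (entry_score s) es"
    using assms mset_ranked sorted_ranked by metis
  thus ?thesis using inj_entry_score[OF s] by (simp add: inj_map_eq_map)
qed

text \<open>Deleting \<open>a\<close> from the new ranking leaves a sorted list of the old entries,
  which by uniqueness is the old ranking.\<close>

lemma ranked_add_mset:
  assumes "inj s"
  obtains l1 l2 where "ranked s E = l1 @ l2" "ranked s (add_mset a E) = l1 @ a # l2"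
proof -
  have "a \<in> set (ranked s (add_mset a E))"
    by (metis mset_ranked set_mset_mset union_single_eq_member)
  then obtain l1 l2 where l: "ranked s (add_mset a E) = l1 @ a # l2"
    by (meson split_list)
  hence "mset (l1 @ l2) = E"
    using mset_ranked[of s "add_mset a E"] by simp
  moreover have "sorted_wrt (\<lambda>e e'. entry_score s e \<ge> entry_score s e') (l1 @ l2)"
    using sorted_ranked[of s "add_mset a E"] unfolding l by (auto simp: sorted_wrt_append)
  ultimately have "ranked s E = l1 @ l2"
    using ranked_unique[OF assms] by metis
  with l show ?thesis by (intro that)
qed

text \<open>One formula for both cases of \<open>top_k\<close>. The amount \<open>N\<close> of
  padding is free, so that selections of sizes \<open>K\<close> and \<open>Suc K\<close> can be read
  off the same padded list.\<close>

lemma top_k_eq_take: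
  assumes "K \<le> N"
  shows "top_k E K s = take K (ranked s E @ replicate N None)"
proof -
  have "length (ranked s E) = size E" by (metis mset_ranked size_mset)
  thus ?thesis using assms by (auto simp: top_k_def min_def)
qed

lemma length_top_k [simp]: "length (top_k E K s) = K"
  by (simp add: top_k_eq_take[OF order_refl])

lemma mset_take_Suc_append_Cons:
  assumes "n < length (l1 @ l2)"
  obtains c where "mset (take (Suc n) (l1 @ a # l2)) = add_mset c (mset (take n (l1 @ l2)))"
proof (cases "length l1 \<le> n")
  case True
  \<comment> \<open>If \<open>a\<close> falls into the prefix, it is the extra entry; otherwise the
    extra entry is the next one of \<open>l1\<close>.\<close>
  thus ?thesis by (intro that[of a]) (simp add: Suc_diff_le)
next
  case False
  thus ?thesis by (intro that[of "l1 ! n"]) (simp add: take_Suc_conv_app_nth)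
qed

text \<open>The smaller selection from \<open>E\<close> serves as the common part when two
  selections of size \<open>Suc K\<close> are compared.\<close>

lemma mset_top_k_add_mset:
  assumes "inj s"
  obtains c where "mset (top_k (add_mset a E) (Suc K) s) = add_mset c (mset (top_k E K s))"
proof -
  obtain l1 l2 where l: "ranked s E = l1 @ l2" "ranked s (add_mset a E) = l1 @ a # l2"
    using ranked_add_mset[OF assms] by blast
  obtain c where "mset (take (Suc K) (l1 @ a # l2 @ replicate (Suc K) None)) =
      add_mset c (mset (take K (l1 @ l2 @ replicate (Suc K) None)))"
    by (rule mset_take_Suc_append_Cons[of K l1 "l2 @ replicate (Suc K) None" a]) simp
  thus ?thesis
    by (intro that[of c]) (simp only: top_k_eq_take[of _ "Suc K"] order_refl le_SucI l append_assoc append_Cons)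
qed

lemma mset_top_k_Suc:
  obtains c where "mset (top_k E (Suc K) s) = add_mset c (mset (top_k E K s))"
  using that[of "(ranked s E @ replicate (Suc K) None) ! K"]
    take_Suc_conv_app_nth[of K "ranked s E @ replicate (Suc K) None"]
  by (simp only: top_k_eq_take[of _ "Suc K"] order_refl le_SucI length_append length_replicate
        trans_less_add2 lessI mset_append mset.simps add_mset_add_single[symmetric] simp_thms)

text \<open>Equality is a separate case because empty selections have no entry to exchange.\<close>

definition substituted :: "'a multiset \<Rightarrow> 'a multiset \<Rightarrow> bool" where
  "substituted E E' \<longleftrightarrow> E = E' \<or> (\<exists>X a b. E = add_mset a X \<and> E' = add_mset b X)"

lemma substituted_sym: "substituted E E' \<Longrightarrow> substituted E' E"
  by (auto simp: substituted_def)

lemma substituted_top_k_add_mset: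
  assumes "inj s"
  shows "substituted (mset (top_k E K s)) (mset (top_k (add_mset a E) K s))"
proof (cases K)
  case (Suc n)
  thus ?thesis
    using mset_top_k_add_mset[OF assms, of a E n] mset_top_k_Suc[of E n s]
    unfolding substituted_def by metis
qed (simp add: substituted_def top_k_def)

text \<open>For a positive size, both selections extend the next smaller selection from the common
  part \<open>X\<close> by one entry. This carries the relation through the second retrieval, made
  inside \<open>dprag\<close>.\<close>

lemma substituted_top_k:
  assumes "inj s" "substituted E E'"
  shows "substituted (mset (top_k E K s)) (mset (top_k E' K s))"
proof (cases K)
  case (Suc n)
  show ?thesis
    using assms(2) unfolding substituted_def
  proof (elim disjE exE conjE)
    fix X a b assume "E = add_mset a X" "E' = add_mset b X"
    thus "mset (top_k E K s) = mset (top_k E' K s) \<or>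
        (\<exists>X a b. mset (top_k E K s) = add_mset a X \<and> mset (top_k E' K s) = add_mset b X)"
      using mset_top_k_add_mset[OF assms(1), of a X n] mset_top_k_add_mset[OF assms(1), of b X n] Suc
      by metis
  qed simp
qed (simp add: substituted_def top_k_def)

lemma substituted_mset_permutation:
  assumes "substituted (mset es) (mset es')"
  obtains \<pi> j b where "\<pi> permutes {..<length es'}" "permute_list \<pi> es' = es[j := b]"
proof -
  have "\<exists>j b. mset (es[j := b]) = mset es'"
    using assms unfolding substituted_def
  proof (elim disjE exE conjE)
    assume "mset es = mset es'"
    \<comment> \<open>Overwriting position 0 with its own value changes nothing, even in the empty
      list.\<close>
    thus ?thesis by (intro exI[of _ 0] exI[of _ "es ! 0"]) simp
  next
    fix X a b assume X: "mset es = add_mset a X" "mset es' = add_mset b X"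
    then obtain j where j: "j < length es" "es ! j = a"
      by (metis in_set_conv_nth set_mset_mset union_single_eq_member)
    thus ?thesis using X by (intro exI[of _ j] exI[of _ b]) (simp add: mset_update)
  qed
  then obtain j b where "mset (es[j := b]) = mset es'" by blast
  thus ?thesis using that by (metis mset_eq_permutation)
qed

text \<open>Chunks are multisets, so moving the entries and the labels of the positions together
  leaves each chunk unchanged.\<close>

lemma chunk_permute_list:
  assumes \<pi>: "\<pi> permutes {..<length es}"
  shows "chunk (permute_list \<pi> es) (f \<circ> \<pi>) = chunk es f"
proof
  fix i
  let ?A = "{j. j < length es \<and> f (\<pi> j) = i}"
  have "\<pi> ` ?A = {j. j < length es \<and> f j = i}"
  proof (intro equalityI subsetI)
    fix j assume "j \<in> {j. j < length es \<and> f j = i}"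
    thus "j \<in> \<pi> ` ?A"
      using permutes_inverses[OF \<pi>] permutes_in_image[OF permutes_inv[OF \<pi>], of j]
      by (intro image_eqI[of _ _ "inv \<pi> j"]) auto
  qed (use permutes_in_image[OF \<pi>] in auto)
  hence "mset_set {j. j < length es \<and> f j = i} = image_mset \<pi> (mset_set ?A)"
    using image_mset_mset_set[OF permutes_inj_on[OF \<pi>]] by metis
  thus "chunk (permute_list \<pi> es) (f \<circ> \<pi>) i = chunk es f i"
    by (simp add: chunk_def multiset.map_comp comp_def)
       (auto intro!: image_mset_cong simp: permute_list_nth[OF \<pi>])
qed

lemma chunk_list_update:
  assumes "i \<noteq> f j"
  shows "chunk (es[j := b]) f i = chunk es f i"
proof -
  have "es[j := b] ! l = es ! l" if "f l = i" for l
    using assms that by (metis nth_list_update_neq)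
  thus ?thesis by (auto simp: chunk_def intro!: image_mset_cong)
qed

text \<open>Only voter \<open>i0\<close> can change its answer, so the set of voters for
  \<open>v\<close> gains at most one member.\<close>

lemma votes_le:
  assumes "\<And>i. i \<noteq> i0 \<Longrightarrow> C i = C' i"
  shows "votes P x C ys v \<le> votes P x C' ys v + 1"
proof -
  have "card {i. i < voters P \<and> llm P x (C i) ys = v} \<le>
      card (insert i0 {i. i < voters P \<and> llm P x (C' i) ys = v})"
    using assms by (intro card_mono) auto
  also have "\<dots> \<le> card {i. i < voters P \<and> llm P x (C' i) ys = v} + 1"
    by (simp add: card_insert_if)
  finally show ?thesis by (simp add: votes_def)
qed

section \<open>Uniform random splits\<close>

lemma finite_splits: "finite (splits m k')"
  unfolding splits_def by (rule finite_subset[OF _ finite_PiE[of "{..<m * k'}" "\<lambda>_. {..<m}"]]) auto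

lemma splits_nonempty: "splits m k' \<noteq> {}"
proof -
  let ?f = "restrict (\<lambda>j. j div k') {..<m * k'}"
  have "?f j < m" if "j < m * k'" for j
    using that by (simp add: less_mult_imp_div_less)
  moreover have "card {j. j < m * k' \<and> ?f j = i} = k'" if "i < m" for i
  proof (cases "k' = 0")
    case False
    have le: "(i + 1) * k' \<le> m * k'" using that by (intro mult_right_mono) auto
    have "j div k' = i \<longleftrightarrow> j \<in> {i * k'..<(i + 1) * k'}" for j
    proof -
      have "j div k' = i \<longleftrightarrow> i \<le> j div k' \<and> j div k' < i + 1" by auto
      thus ?thesis
        using False by (simp only: less_eq_div_iff_mult_less_eq div_less_iff_less_mult neq0_conv atLeastLessThan_iff)
    qed
    hence "{j. j < m * k' \<and> ?f j = i} = {j. j < m * k' \<and> j \<in> {i * k'..<(i + 1) * k'}}"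
      by (intro Collect_cong) (simp cong: conj_cong del: atLeastLessThan_iff)
    also have "\<dots> = {i * k'..<(i + 1) * k'}"
      using le by auto
    finally have "card {j. j < m * k' \<and> ?f j = i} = card {i * k'..<(i + 1) * k'}"
      by (rule arg_cong)
    thus ?thesis by simp
  qed simp
  ultimately have "?f \<in> splits m k'" by (auto simp: splits_def)
  thus ?thesis by blast
qed

lemma splits_comp:
  assumes \<pi>: "\<pi> permutes {..<m * k'}" and f: "f \<in> splits m k'"
  shows "f \<circ> \<pi> \<in> splits m k'"
proof -
  have "card {j. j < m * k' \<and> f (\<pi> j) = i} = card {j. j < m * k' \<and> f j = i}" for i
  proof (rule bij_betw_same_card[of \<pi>], rule bij_betw_byWitness[where f' = "inv \<pi>"])
  qed (use permutes_inverses[OF \<pi>] permutes_in_image[OF \<pi>] permutes_in_image[OF permutes_inv[OF \<pi>]] in auto)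
  moreover have "f \<circ> \<pi> \<in> {..<m * k'} \<rightarrow>\<^sub>E {..<m}"
    using f permutes_in_image[OF \<pi>] permutes_not_in[OF \<pi>]
    by (auto simp: splits_def PiE_iff extensional_def)
  ultimately show ?thesis using f by (auto simp: splits_def)
qed

lemma bij_betw_splits_comp:
  assumes \<pi>: "\<pi> permutes {..<m * k'}"
  shows "bij_betw (\<lambda>f. f \<circ> \<pi>) (splits m k') (splits m k')"
  by (rule bij_betw_byWitness[where f' = "\<lambda>f. f \<circ> inv \<pi>"])
     (use splits_comp[OF \<pi>] splits_comp[OF permutes_inv[OF \<pi>]] permutes_inv_o[OF \<pi>] in
       \<open>auto simp: comp_assoc\<close>)

text \<open>A bijection of \<open>A\<close> preserves the uniform law, so a random split may be
  replaced by its composition with a fixed permutation of the positions.\<close>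

lemma bind_pmf_of_set_bij:
  assumes \<phi>: "bij_betw \<phi> A A" and A: "finite A" "A \<noteq> {}"
    and H: "\<And>x. H x \<in> space (prob_algebra N)"
  shows "measure_pmf (pmf_of_set A) \<bind> (\<lambda>x. H (\<phi> x)) = measure_pmf (pmf_of_set A) \<bind> H"
proof -
  have "pmf_of_set A = map_pmf \<phi> (pmf_of_set A)"
    using map_pmf_of_set_inj[of \<phi> A] \<phi> A by (simp add: bij_betw_def)
  hence "measure_pmf (pmf_of_set A) = distr (pmf_of_set A) (count_space UNIV) \<phi>"
    by (metis map_pmf_rep_eq)
  moreover have "H \<in> count_space UNIV \<rightarrow>\<^sub>M subprob_algebra N"
    using H measurable_prob_algebraD[of H "count_space UNIV" N] by auto
  ultimately show ?thesis
    using bind_distr[of \<phi> "pmf_of_set A" "count_space UNIV" H N] by simp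
qed

section \<open>Composition\<close>

text \<open>The bind is a finite mixture, so the mass of each set is a finite sum of measurable
  functions.\<close>

lemma measurable_bind_finite_pmf:
  assumes h: "\<And>i. h i \<in> M \<rightarrow>\<^sub>M prob_algebra N" and p: "finite (set_pmf p)"
  shows "(\<lambda>x. measure_pmf p \<bind> (\<lambda>i. h i x)) \<in> M \<rightarrow>\<^sub>M prob_algebra N"
proof -
  have H: "(\<lambda>i. h i x) \<in> count_space UNIV \<rightarrow>\<^sub>M prob_algebra N" if "x \<in> space M" for x
    using measurable_space[OF h that] by auto
  note B = bind_in_prob_algebra[OF measure_pmf_in_prob_algebra H]
  show ?thesis
  proof (intro measurable_prob_algebraI measurable_subprob_algebra)
    fix S assume S: "S \<in> sets N"
    have "(\<lambda>x. emeasure (h i x) S) \<in> borel_measurable M" for i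
      using measurable_compose[OF measurable_prob_algebraD[OF h] measurable_emeasure_subprob_algebra[OF S]] .
    hence "(\<lambda>x. \<Sum>i\<in>set_pmf p. emeasure (h i x) S * ennreal (pmf p i)) \<in> borel_measurable M"
      by measurable
    moreover have "emeasure (measure_pmf p \<bind> (\<lambda>i. h i x)) S =
        (\<Sum>i\<in>set_pmf p. emeasure (h i x) S * ennreal (pmf p i))" if "x \<in> space M" for x
      using emeasure_bind_prob_algebra[OF measure_pmf_in_prob_algebra H[OF that] S] p
      by (simp add: nn_integral_measure_pmf_finite)
    ultimately show "(\<lambda>x. emeasure (measure_pmf p \<bind> (\<lambda>i. h i x)) S) \<in> borel_measurable M"
      by (simp cong: measurable_cong)
  qed (use B in \<open>auto simp: space_prob_algebra intro: prob_space_imp_subprob_space\<close>)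
qed

lemma measurable_dprag_split:
  assumes "token_budget P > 0"
  shows "(\<lambda>\<theta>. measure_pmf (pmf_of_set (splits m k')) \<bind> (\<lambda>f. dprag_loop P x (C f) n c \<theta> ys))
    \<in> borel \<rightarrow>\<^sub>M prob_algebra (count_space UNIV)"
  by (intro measurable_bind_finite_pmf measurable_dprag_loop assms)
     (simp add: finite_splits splits_nonempty)

lemma dprag_in_prob_algebra:
  assumes "token_budget P > 0"
  shows "dprag P x E \<epsilon> \<in> space (prob_algebra (count_space UNIV))"
  unfolding dprag_def Let_def
  by (auto intro!: return_in_prob_algebra measurable_dprag_split assms
        bind_in_prob_algebra[OF noisy_threshold_in_prob_algebra[OF assms]])

lemma dp_le_dprag:
  fixes P :: "'v::finite rag"
  assumes tb: "token_budget P > 0" and \<epsilon>: "\<epsilon> \<ge> 0"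
    and ties: "inj (\<lambda>z. relevance P z x)" and E: "substituted E E'"
  shows "dp_le \<epsilon> (dprag P x E \<epsilon>) (dprag P x E' \<epsilon>)"
proof -
  let ?c = "nat \<lfloor>\<epsilon> / token_budget P\<rfloor>" and ?m = "voters P" and ?k = "docs_per_voter P"
  let ?es = "\<lambda>E. top_k E (?m * ?k) (\<lambda>z. relevance P z x)"
  let ?U = "measure_pmf (pmf_of_set (splits ?m ?k))"
  let ?L = "\<lambda>E f \<theta>. dprag_loop P x (chunk (?es E) f) (max_tokens P) ?c \<theta> []"
  let ?pr = "prob_algebra (count_space (UNIV :: 'v list set))"
  show ?thesis
  proof (cases "?c = 0")
    case True
    thus ?thesis using \<epsilon> by (simp add: dprag_def dp_le_refl)
  next
    case False
    obtain \<pi> j b where \<pi>: "\<pi> permutes {..<?m * ?k}" and es: "permute_list \<pi> (?es E') = (?es E)[j := b]"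
      using substituted_mset_permutation[OF substituted_top_k[OF ties E]] length_top_k by metis
    \<comment> \<open>The split \<open>f \<circ> \<pi>\<close> of the first list is matched with the
      split \<open>f\<close> of the second: after permuting, the lists differ only at position
      \<open>j\<close>, so only the chunk containing \<open>j\<close> can differ.\<close>
    have agree: "chunk (?es E) (f \<circ> \<pi>) i = chunk (?es E') f i" if "i \<noteq> (f \<circ> \<pi>) j" for f i
      using chunk_list_update[of i "f \<circ> \<pi>" j "?es E" b] that \<pi> es
      by (metis chunk_permute_list length_top_k)
    have loop: "dp_le (real ?c * token_budget P - eps_lap P / 2) (?L E (f \<circ> \<pi>) \<theta>) (?L E' f (\<theta> - 1))" for f \<theta>
    proof (rule dp_le_dprag_loop[OF tb votes_le[of "(f \<circ> \<pi>) j"] votes_le[of "(f \<circ> \<pi>) j"]])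
      show "1 \<le> ?c" using False by linarith
    qed (simp_all only: agree not_False_eq_True)
    have Ls: "?L E f \<theta> \<in> space ?pr" for E f \<theta>
      using measurable_space[OF measurable_dprag_loop[OF tb]] by simp
    have "dp_le (0 + (real ?c * token_budget P - eps_lap P / 2))
        (?U \<bind> (\<lambda>f. ?L E (f \<circ> \<pi>) \<theta>)) (?U \<bind> (\<lambda>f. ?L E' f (\<theta> - 1)))" for \<theta>
      using Ls loop
      by (intro dp_le_bind[OF measure_pmf_in_prob_algebra measure_pmf_in_prob_algebra, where B = "count_space UNIV"]
          dp_le_refl) auto
    moreover have "?U \<bind> (\<lambda>f. ?L E (f \<circ> \<pi>) \<theta>) = ?U \<bind> (\<lambda>f. ?L E f \<theta>)" for \<theta>
      by (rule bind_pmf_of_set_bij[OF bij_betw_splits_comp[OF \<pi>] finite_splits splits_nonempty Ls])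
    ultimately have U: "dp_le (real ?c * token_budget P - eps_lap P / 2)
        (?U \<bind> (\<lambda>f. ?L E f \<theta>)) (?U \<bind> (\<lambda>f. ?L E' f (\<theta> - 1)))" for \<theta>
      by simp
    have "dp_le (eps_lap P / 2 + (real ?c * token_budget P - eps_lap P / 2))
        (dprag P x E \<epsilon>) (dprag P x E' \<epsilon>)"
      unfolding dprag_def Let_def if_not_P[OF False]
      by (rule dp_le_bind_shift[OF noisy_threshold_in_prob_algebra[OF tb] _ measurable_dprag_split[OF tb]
            measurable_dprag_split[OF tb] dp_le_noisy_threshold_shift[OF tb] U]) simp
    \<comment> \<open>The floor in the number of discoveries keeps their total price within
      \<open>\<epsilon>\<close>.\<close>
    moreover have "real ?c * token_budget P \<le> \<epsilon>"
      using tb \<epsilon> by (simp add: pos_le_divide_eq[symmetric])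
    ultimately show ?thesis by (auto intro: dp_le_mono)
  qed
qed

section \<open>Budget accounting over the query sequence\<close>

lemma murag_from_in_prob_algebra:
  assumes "token_budget P > 0"
  shows "murag_from P k \<epsilon>\<^sub>q \<tau> D qs B \<in> space (prob_algebra (count_space UNIV))"
proof (induction qs arbitrary: B)
  case (Cons q qs)
  show ?case
    unfolding murag_from.simps Let_def
    by (intro bind_in_prob_algebra[OF dprag_in_prob_algebra[OF assms]])
       (auto intro!: bind_in_prob_algebra[OF Cons.IH] simp: return_in_prob_algebra)
qed (simp add: return_in_prob_algebra)

lemma murag_from_cong:
  "(\<And>y. y \<in> D \<Longrightarrow> B y = B' y) \<Longrightarrow> murag_from P k \<epsilon>\<^sub>q \<tau> D qs B = murag_from P k \<epsilon>\<^sub>q \<tau> D qs B'"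
proof (induction qs arbitrary: B B')
  case (Cons q qs)
  let ?Dq = "\<lambda>B. {z \<in> {z \<in> D. \<epsilon>\<^sub>q \<le> B z}. \<tau> < relevance P z q}"
  let ?B = "\<lambda>B z. if z \<in> ?Dq B then B z - \<epsilon>\<^sub>q else B z"
  have "?Dq B = ?Dq B'" using Cons.prems by auto
  moreover have "murag_from P k \<epsilon>\<^sub>q \<tau> D qs (?B B) = murag_from P k \<epsilon>\<^sub>q \<tau> D qs (?B B')"
    using Cons.prems by (intro Cons.IH) auto
  ultimately show ?case
    unfolding murag_from.simps Let_def by presburger
qed simp

text \<open>The remaining budget of \<open>z\<close> acts as a potential. A query that retrieves
  \<open>z\<close> costs \<open>\<epsilon>\<^sub>q\<close> and lowers \<open>B z\<close> by the same
  amount; any other query receives identical input in both runs and costs nothing.\<close>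

lemma dp_le_murag_from:
  fixes P :: "'v::finite rag"
  assumes ties: "\<And>q. inj (\<lambda>z. relevance P z q)" and tb: "token_budget P > 0"
    and \<epsilon>q: "\<epsilon>\<^sub>q > 0" and D: "finite D" "z \<notin> D" and B: "B z \<ge> 0"
  shows "dp_le (B z) (murag_from P k \<epsilon>\<^sub>q \<tau> D qs B) (murag_from P k \<epsilon>\<^sub>q \<tau> (insert z D) qs B) \<and>
    dp_le (B z) (murag_from P k \<epsilon>\<^sub>q \<tau> (insert z D) qs B) (murag_from P k \<epsilon>\<^sub>q \<tau> D qs B)"
  using B
proof (induction qs arbitrary: B)
  case Nil
  thus ?case by (simp add: dp_le_refl)
next
  case (Cons q qs)
  define Dq where "Dq D = {y \<in> {y \<in> D. \<epsilon>\<^sub>q \<le> B y}. \<tau> < relevance P y q}" for D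
  \<comment> \<open>The update is formed with the larger dataset; on \<open>D\<close> it agrees with
    the update of the smaller run, since retrieval is decided document by document and
    \<open>z\<close> is not in \<open>D\<close>.\<close>
  define B' where "B' = (\<lambda>y. if y \<in> Dq (insert z D) then B y - \<epsilon>\<^sub>q else B y)"
  define d where "d = (if z \<in> Dq (insert z D) then \<epsilon>\<^sub>q else 0)"
  define R where "R D = dprag P q (mset (top_k (dataset_entries (Dq D)) k (\<lambda>z. relevance P z q))) \<epsilon>\<^sub>q" for D
  define Q where "Q D = (\<lambda>a. murag_from P k \<epsilon>\<^sub>q \<tau> D qs B' \<bind> (\<lambda>as. return (count_space UNIV) (a # as)))" for D
  \<comment> \<open>A document is retrieved only while its budget is at least
    \<open>\<epsilon>\<^sub>q\<close>, so the potential never becomes negative.\<close>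
  have B': "B z = d + B' z" "B' z \<ge> 0"
    using Cons.prems by (auto simp: d_def B'_def Dq_def)
  have Dq: "Dq (insert z D) = (if z \<in> Dq (insert z D) then insert z (Dq D) else Dq D)"
    using D by (auto simp: Dq_def)
  have step: "murag_from P k \<epsilon>\<^sub>q \<tau> A (q # qs) B = R A \<bind> Q A" if "A = D \<or> A = insert z D" for A
  proof -
    have "murag_from P k \<epsilon>\<^sub>q \<tau> A qs (\<lambda>y. if y \<in> Dq A then B y - \<epsilon>\<^sub>q else B y) =
        murag_from P k \<epsilon>\<^sub>q \<tau> A qs B'"
      using that D by (intro murag_from_cong) (auto simp: B'_def Dq_def)
    thus ?thesis by (simp only: murag_from.simps Let_def Dq_def R_def Q_def)
  qed
  have R: "dp_le d (R D) (R (insert z D))" "dp_le d (R (insert z D)) (R D)"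
  proof -
    have "substituted (mset (top_k (dataset_entries (Dq D)) k (\<lambda>z. relevance P z q)))
        (mset (top_k (dataset_entries (insert z (Dq D))) k (\<lambda>z. relevance P z q)))"
    proof -
      have "dataset_entries (insert z (Dq D)) = add_mset (Some z) (dataset_entries (Dq D))"
        using D by (simp add: dataset_entries_def Dq_def)
      thus ?thesis using substituted_top_k_add_mset[OF ties] by metis
    qed
    note S = this substituted_sym[OF this]
    show "dp_le d (R D) (R (insert z D))" "dp_le d (R (insert z D)) (R D)"
      using S dp_le_dprag[OF tb _ ties, of \<epsilon>\<^sub>q] \<epsilon>q Dq by (auto simp: R_def d_def dp_le_refl)
  qed
  note ms = murag_from_in_prob_algebra[OF tb]
  have Qs: "Q A a \<in> space (prob_algebra (count_space UNIV))" for A a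
    unfolding Q_def by (intro bind_in_prob_algebra[OF ms]) (simp add: return_in_prob_algebra)
  have Q: "dp_le (B' z) (Q D a) (Q (insert z D) a)" "dp_le (B' z) (Q (insert z D) a) (Q D a)" for a
    unfolding Q_def using Cons.IH[of B'] B'(2)
    by (auto intro!: dp_le_bind[OF ms ms, where e = 0 and B = "count_space UNIV", simplified] dp_le_refl simp: return_in_prob_algebra)
  show ?case
    unfolding step[OF disjI1[OF refl]] step[OF disjI2[OF refl]] B'(1)
    using R Q Qs dprag_in_prob_algebra[OF tb]
    by (intro conjI dp_le_bind[where A = "count_space UNIV" and B = "count_space UNIV"]) (auto simp: R_def)
qed

theorem theorem1:
  fixes P :: "'v::finite rag"
    and T k M :: nat
    and \<epsilon>\<^sub>q \<tau> \<epsilon> :: real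
    and qs :: "'v list list"
  assumes no_ties: "\<And>q. inj (\<lambda>z. relevance P z q)"
    and token_budget: "token_budget P > 0"
    and "T \<ge> 1" and "k \<ge> 1" and "M \<ge> 1"
    and "\<epsilon>\<^sub>q > 0"
    and "length qs = T"
    and "\<epsilon> > 0"
    and budget: "\<And>z. initial_budget M \<epsilon>\<^sub>q (z :: 'v doc) \<le> \<epsilon>"
  shows "differentially_private (count_space UNIV) \<epsilon> (murag P k M \<epsilon>\<^sub>q \<tau> qs)"
proof -
  let ?A = "murag P k M \<epsilon>\<^sub>q \<tau> qs"
  have pr: "?A D \<in> space (prob_algebra (count_space UNIV))" for D
    unfolding murag_def by (rule murag_from_in_prob_algebra[OF token_budget])
  have "dp_le \<epsilon> (?A D) (?A (insert z D)) \<and> dp_le \<epsilon> (?A (insert z D)) (?A D)"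
    if "finite D" "z \<notin> D" for D z
    \<comment> \<open>The potential of \<open>z\<close> starts at
      \<open>initial_budget M \<epsilon>\<^sub>q z\<close>, which is at most
      \<open>\<epsilon>\<close>.\<close>
    using dp_le_murag_from[OF no_ties token_budget \<open>\<epsilon>\<^sub>q > 0\<close> that, of "initial_budget M \<epsilon>\<^sub>q" k \<tau> qs]
      budget[of z] \<open>\<epsilon>\<^sub>q > 0\<close>
    by (auto simp: murag_def initial_budget_def intro: dp_le_mono)
  hence le: "dp_le \<epsilon> (?A D) (?A D')" if "neighbouring D D'" for D D'
    using that by (auto simp: neighbouring_def)
  have "measure (?A D) S \<le> exp \<epsilon> * measure (?A D') S" if "neighbouring D D'" for D D' S
  proof -
    interpret D: prob_space "?A D" using pr by (simp add: space_prob_algebra)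
    interpret D': prob_space "?A D'" using pr by (simp add: space_prob_algebra)
    have "S \<in> sets (?A D)" using pr by (simp add: space_prob_algebra)
    hence "emeasure (?A D) S \<le> ennreal (exp \<epsilon>) * emeasure (?A D') S"
      using le[OF that] by (auto simp: dp_le_def)
    thus ?thesis
      by (simp add: D.emeasure_eq_measure D'.emeasure_eq_measure flip: ennreal_mult)
  qed
  thus ?thesis using pr by (simp add: differentially_private_def)
qed

end
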